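(* Let $n\ge 3$ and $t\geq 1$ be integers and let $k_0,\dots,k_{t-1}$ be mutually distinct integers with $1\le k_i\le\frac{n-1}{2}$ for $0\le i<t$. Let $\mathcal C=(\mathrm C_n(k_0),\dots,\mathrm C_n(k_{t-1}))$, viewed as a $t$-decomposition of $\mathrm C_n(k_0,\dots,k_{t-1})$. (a) Let $h\ge1$ be an integer, $t=2^{h+1}$, and $\overline{\mathcal H}=(\overline{\mathrm T}_{3,h,0},\overline{\mathrm T}_{3,h,1},\dots,\overline{\mathrm T}_{3,h,t-1})$. For $1\le j\le n$ let $\overline\Theta_j$ be the diagonal matrix, indexed by the vertices of $\overline{\mathrm T}_{3,h}$, whose diagonal entry is $0$ at every vertex which is not a leaf and is $2\cos\frac{2\pi jk_i}{n}$ at the $i$th leaf. Then $$\phi(\mathcal C\boxtimes\overline{\mathcal H},x)=\prod_{j=1}^n\phi\left(\overline T_{3,h}+\overline\Theta_j,x\right)=\prod_{j=1}^nR\big(\overline{\mathrm T}^{\,j}_{3,h}\big)\,\frac{R_{\overline{\mathrm T}^{\,j}_{3,h}}(0)-1}{R_{\overline{\mathrm T}^{\,j}_{3,h}}(0)},$$ where $\overline{\mathrm T}^{\,j}_{3,h}$ is the labeled tree $\overline{\mathrm T}_{3,h}$ whose $i$th leaf is labeled by $x-2\cos\frac{2\pi jk_i}{n}$. (b) Let $h\ge1$ be an integer, $t=3\times2^{h-1}$, and $\mathcal H^\bullet=(\mathrm T^\bullet_{3,h,0},\mathrm T^\bullet_{3,h,1},\dots,\mathrm T^\bullet_{3,h,t-1})$.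 For $1\le j\le n$ let $\Theta^\bullet_j$ be the diagonal matrix, indexed by the vertices of $\mathrm T^\bullet_{3,h}$, whose diagonal entry is $0$ at every vertex which is not a leaf and is $2\cos\frac{2\pi jk_i}{n}$ at the $i$th leaf. Then $$\phi(\mathcal C\boxtimes\mathcal H^\bullet,x)=\prod_{j=1}^n\phi\left(T^\bullet_{3,h}+\Theta^\bullet_j,x\right)=\prod_{j=1}^nR\big(\mathrm T^{\bullet j}_{3,h}\big),$$ where $\mathrm T^{\bullet j}_{3,h}$ is the labeled tree $\mathrm T^\bullet_{3,h}$ whose $i$th leaf is labeled by $x-2\cos\frac{2\pi jk_i}{n}$.
   Context: All graphs are finite and simple. A graph is written in roman type and its adjacency matrix in italic type (so $\overline T_{3,h}$, $T^\bullet_{3,h}$ are the adjacency matrices of $\overline{\mathrm T}_{3,h}$, $\mathrm T^\bullet_{3,h}$). $\phi(M,x)=\det(xI-M)$; for a graph, $\phi$ is that of its adjacency matrix. **Circulant graphs.** $\mathrm C_n(k)$ is the graph on $\{0,\dots,n-1\}$ with edges $uv$, $v\equiv u+k\pmod n$; $\mathrm C_n(k_0,\dots,k_{t-1})$ is the graph on the same vertex set whose edge set is the (disjoint) union of those of the $\mathrm C_n(k_i)$. **Trees.** $\mathrm T^\bullet_{3,h}$ is the complete rooted $3$-regular tree of height $h$: level $0$ consists of the root, which has $3$ children; every vertex at levels $1,\dots,h-1$ has exactly $2$ children; the vertices of level $h$ are the leaves ($3\times2^{h-1}$ of them). $\overline{\mathrm T}_{3,h}$ is the complete unrooted $3$-regular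 tree of height $h$: level $0$ consists of two adjacent vertices; every vertex at levels $0,\dots,h-1$ has exactly $2$ children in the next level; the vertices of level $h$ are the leaves ($2^{h+1}$ of them). In both, the leaves are numbered consecutively from left to right starting with $0$. **Tree cylinders.** $\mathrm T^\bullet_{3,h,i}$ (resp. $\overline{\mathrm T}_{3,h,i}$) is the graph consisting of two disjoint copies (the two bases) of $\mathrm T^\bullet_{3,h}$ (resp. $\overline{\mathrm T}_{3,h}$) plus one single edge joining the $i$th leaf of one copy to the $i$th leaf of the other copy. **Cylindrical construct.** For a decomposition $\mathcal C=(\mathrm G_0,\dots,\mathrm G_{t-1})$ of a graph into edge-disjoint spanning subgraphs and a list $\mathcal H=(\mathrm H_0,\dots,\mathrm H_{t-1})$ of cylinders with the same base, $\mathcal C\boxtimes\mathcal H$ is obtained by replacing each edge $uv$ of $\mathrm G_i$ by a copy of $\mathrm H_i$ (one base at $u$, the other at $v$), for all $i$, and identifying, vertex by corresponding vertex, all bases located at the same vertex. For the tree cylinders above, with base tree having adjacency matrix $B$, this means that $\mathcal C\boxtimes\mathcal H$ is the graph with adjacency matrix $I_n\otimes B+\sum_{i=0}^{t-1}G_i\otimes E_i$, where $E_i$ is the matrix indexed by the vertices of the base tree with a single nonzero entry, equal to $1$, at the diagonal position of the $i$th leaf. **Tree-mixing and resultants.** Let $\mathrm T$ be one of the trees $\overline{\mathrm T}_{3,h}$, $\mathrm T^\bullet_{3,h}$, with labels in $\mathbb R[x]$ assigned to its leaves. Labels in the field $\mathbb R(x)$ of rational functions are assigned recursively to all other vertices,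 from the leaves towards level $0$: a vertex whose two children (neighbours in the next level) have labels $b$ and $c$ gets the label $x-(b^{-1}+c^{-1})$; the root of $\mathrm T^\bullet_{3,h}$, whose three children have labels $b,c,d$, gets the label $x-(b^{-1}+c^{-1}+d^{-1})$. The resultant of level $\ell$ is $R_{\mathrm T}(\ell)$, the product of the labels of all vertices of level $\ell$, and the resultant of the labeled tree is $R(\mathrm T)=\prod_{\ell=0}^hR_{\mathrm T}(\ell)$. *)

theory Defs
  imports
    Complex_Main
    "HOL-Library.Countable_Set"
    "HOL-Computational_Algebra.Polynomial_Factorial"
    "HOL-Number_Theory.Cong"
    "Jordan_Normal_Form.Char_Poly"
    "Graph_Theory.Pair_Digraph"
begin

text \<open>
  A finite simple graph is a \<^locale>\<open>pair_graph\<close>: an edge \<open>uv\<close> is the pair of arcs \<open>(u, v)\<close>, \<open>(v, u)\<close>.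

  A square matrix whose rows and columns are indexed by a finite set \<open>V\<close> is a function
  \<open>'a \<Rightarrow> 'a \<Rightarrow> real\<close>, of which only the values on \<open>V\<close> matter. Its characteristic polynomial is that
  of the matrix obtained by enumerating \<open>V\<close>; the enumeration is irrelevant
  (lemma \<open>charpoly_on_enum\<close>).
\<close>

definition charpoly_on :: "'a set \<Rightarrow> ('a \<Rightarrow> 'a \<Rightarrow> real) \<Rightarrow> real poly" where
  "charpoly_on V M =
     char_poly (mat (card V) (card V) (\<lambda>(i, j). M (from_nat_into V i) (from_nat_into V j)))"

lemma charpoly_on_enum:
  assumes V: "finite V" and g: "bij_betw g {..<card V} V"
  shows "charpoly_on V M = char_poly (mat (card V) (card V) (\<lambda>(i, j). M (g i) (g j)))"
proof -
  let ?N = "card V" and ?f = "from_nat_into V"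
  have f: "bij_betw ?f {..<?N} V" using bij_betw_from_nat_into_finite[OF V] .
  define s where "s = (\<lambda>i. the_inv_into {..<?N} g (?f i))"
  have s: "bij_betw s {..<?N} {..<?N}"
    unfolding s_def using bij_betw_trans[OF f bij_betw_the_inv_into[OF g]] by (simp add: o_def)
  have sN: "s i < ?N" if "i < ?N" for i
    using s that by (auto simp: bij_betw_def)
  have gs: "g (s i) = ?f i" if "i < ?N" for i
    unfolding s_def using g f that by (intro f_the_inv_into_f_bij_betw[of g "{..<?N}" V]) (auto simp: bij_betw_def)
  define P where "P = mat ?N ?N (\<lambda>(i, j). if j = s i then 1 else (0::real))"
  define A where "A = mat ?N ?N (\<lambda>(i, j). M (?f i) (?f j))"
  define B where "B = mat ?N ?N (\<lambda>(i, j). M (g i) (g j))"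
  have sinj: "s i = s j \<longleftrightarrow> i = j" if "i < ?N" "j < ?N" for i j
    using s that by (auto simp: bij_betw_def inj_on_def)
  have PB: "P * B = mat ?N ?N (\<lambda>(i, j). M (?f i) (g j))"
    by (rule eq_matI) (auto simp: P_def B_def scalar_prod_def sN gs if_distrib[of "\<lambda>x. x * _"] cong: if_cong)
  have PBQ: "P * B * transpose_mat P = A" unfolding PB
    by (rule eq_matI) (auto simp: P_def A_def scalar_prod_def sN gs if_distrib[of "\<lambda>x. _ * x"] cong: if_cong)
  have 1: "P * transpose_mat P = 1\<^sub>m ?N"
    by (rule eq_matI) (auto simp: P_def scalar_prod_def sN sinj if_distrib[of "\<lambda>x. x * _"] cong: if_cong)
  have P: "P \<in> carrier_mat ?N ?N" by (simp add: P_def)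
  have 2: "transpose_mat P * P = 1\<^sub>m ?N"
    using mat_mult_left_right_inverse[OF P _ 1] P by simp
  have "similar_mat A B"
    by (rule similar_matI[of A B P "transpose_mat P" ?N]) (use 1 2 P PBQ in \<open>auto simp: A_def B_def\<close>)
  then show ?thesis
    using char_poly_similar by (simp add: charpoly_on_def A_def B_def)
qed

definition adjacency :: "'a pair_pre_digraph \<Rightarrow> 'a \<Rightarrow> 'a \<Rightarrow> real" where
  "adjacency G u v = (if (u, v) \<in> parcs G then 1 else 0)"

definition graph_charpoly :: "'a pair_pre_digraph \<Rightarrow> real poly" where
  "graph_charpoly G = charpoly_on (pverts G) (adjacency G)"

definition circulant :: "nat \<Rightarrow> int \<Rightarrow> nat pair_pre_digraph" where
  "circulant n k = \<lparr> pverts = {0..<n},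
     parcs = {(u, v). u < n \<and> v < n \<and>
                ([int v = int u + k] (mod int n) \<or> [int u = int v + k] (mod int n))} \<rparr>"

lemma pair_graph_circulant:
  assumes "1 \<le> k" "k < int n"
  shows "pair_graph (circulant n k)"
proof
  show "symmetric (with_proj (circulant n k))"
    by (auto simp: symmetric_def circulant_def intro!: symI)
  have "parcs (circulant n k) \<subseteq> {0..<n} \<times> {0..<n}"
    by (auto simp: circulant_def)
  then show "finite (parcs (circulant n k))"
    by (rule finite_subset) simp
  have "\<not> [x = x + k] (mod int n)" for x
    using assms by (auto simp: cong_iff_dvd_diff zdvd_not_zless)
  then show "fst e \<noteq> snd e" if "e \<in> parcs (circulant n k)" for e
    using that by (auto simp: circulant_def)
qed (auto simp: circulant_def)

lemma circulant_arc_disjoint: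
  assumes "1 \<le> k" "2 * k < int n" "1 \<le> k'" "2 * k' < int n" "k \<noteq> k'"
  shows "parcs (circulant n k) \<inter> parcs (circulant n k') = {}"
proof -
  have no: "\<not> int n dvd d" if "d \<noteq> 0" "\<bar>d\<bar> < int n" for d
    using that dvd_imp_le_int[of d "int n"] by auto
  have "\<not> int n dvd k - k'" "\<not> int n dvd k' - k" "\<not> int n dvd k + k'" "\<not> int n dvd - k - k'"
    by (rule no; use assms in linarith)+
  moreover have "int n dvd k - k' \<or> int n dvd k' - k \<or> int n dvd k + k' \<or> int n dvd - k - k'"
    if "e \<in> parcs (circulant n k)" "e \<in> parcs (circulant n k')" for e
  proof -
    obtain u v where e: "e = (u, v)" by (cases e)
    let ?d = "int v - int u"
    have "int n dvd ?d - k \<or> int n dvd ?d + k" "int n dvd ?d - k' \<or> int n dvd ?d + k'"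
      using that dvd_minus_iff[of "int n" "?d + k"] dvd_minus_iff[of "int n" "?d + k'"]
      by (auto simp: e circulant_def cong_iff_dvd_diff algebra_simps)
    then show ?thesis
      using dvd_diff[of "int n" "?d - k" "?d - k'"] dvd_diff[of "int n" "?d - k" "?d + k'"]
        dvd_diff[of "int n" "?d + k" "?d - k'"] dvd_diff[of "int n" "?d + k" "?d + k'"]
      by (auto simp: algebra_simps)
  qed
  ultimately show ?thesis by blast
qed


text \<open>
  Both families of trees are treated uniformly: \<open>Rooted\<close> stands for the trees with a single vertex
  at level 0, \<open>Unrooted\<close> for those with two adjacent vertices at level 0. The vertex \<open>(l, i)\<close> is the
  \<open>i\<close>th vertex, from left to right and starting with 0, of level \<open>l\<close>; thus the \<open>i\<close>th leaf of a tree
  of height \<open>h\<close> is \<open>(h, i)\<close>. The children of \<open>(l, i)\<close> are the vertices \<open>(l + 1, j)\<close> with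
  \<open>j \<in> children T l i\<close>.
\<close>

datatype tree_kind = Rooted | Unrooted

fun width :: "tree_kind \<Rightarrow> nat \<Rightarrow> nat" where
  "width Rooted 0 = 1"
| "width Rooted (Suc l) = 3 * 2 ^ l"
| "width Unrooted l = 2 ^ (l + 1)"

fun children :: "tree_kind \<Rightarrow> nat \<Rightarrow> nat \<Rightarrow> nat set" where
  "children Rooted 0 i = {0, 1, 2}"
| "children Rooted (Suc l) i = {2 * i, 2 * i + 1}"
| "children Unrooted l i = {2 * i, 2 * i + 1}"

definition tree_verts :: "tree_kind \<Rightarrow> nat \<Rightarrow> (nat \<times> nat) set" where
  "tree_verts T h = {(l, i). l \<le> h \<and> i < width T l}"

definition down_arcs :: "tree_kind \<Rightarrow> nat \<Rightarrow> (nat \<times> nat) rel" where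
  "down_arcs T h = {((l, i), (Suc l, j)) | l i j. l < h \<and> i < width T l \<and> j \<in> children T l i}"

fun level0_arcs :: "tree_kind \<Rightarrow> (nat \<times> nat) rel" where
  "level0_arcs Rooted = {}"
| "level0_arcs Unrooted = {((0, 0), (0, 1)), ((0, 1), (0, 0))}"

definition tree :: "tree_kind \<Rightarrow> nat \<Rightarrow> (nat \<times> nat) pair_pre_digraph" where
  "tree T h = \<lparr> pverts = tree_verts T h,
                parcs = down_arcs T h \<union> (down_arcs T h)\<inverse> \<union> level0_arcs T \<rparr>"

definition leaf_diag :: "nat \<Rightarrow> (nat \<Rightarrow> real) \<Rightarrow> nat \<times> nat \<Rightarrow> nat \<times> nat \<Rightarrow> real" where
  "leaf_diag h d u v = (if u = v \<and> fst u = h then d (snd u) else 0)"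


text \<open>
  A cylinder with base vertices of type \<open>'b\<close> is a graph on the vertices \<open>(a, s)\<close>, where the Boolean
  \<open>s\<close> tells the two bases apart.
\<close>

definition tree_cylinder ::
    "tree_kind \<Rightarrow> nat \<Rightarrow> nat \<Rightarrow> ((nat \<times> nat) \<times> bool) pair_pre_digraph" where
  "tree_cylinder T h i = \<lparr> pverts = tree_verts T h \<times> UNIV,
     parcs = {((a, s), (b, s)) | a b s. (a, b) \<in> parcs (tree T h)} \<union>
             {(((h, i), s), ((h, i), \<not> s)) | s. True} \<rparr>"

text \<open>
  In \<open>cylindrical_construct Gs Hs\<close>, the vertex \<open>(u, a)\<close> is the vertex \<open>a\<close> of the (common) base at
  the vertex \<open>u\<close>. For an arc \<open>(u, v)\<close> of \<open>Gs ! i\<close>, the base \<open>False\<close> of \<open>Hs ! i\<close> is put at \<open>u\<close> and the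
  base \<open>True\<close> at \<open>v\<close>. An edge is a pair of opposite arcs, but it is still replaced by a single copy
  of a tree cylinder, because tree cylinders are invariant under exchanging the two bases.
\<close>

definition cylindrical_construct ::
    "'a pair_pre_digraph list \<Rightarrow> ('b \<times> bool) pair_pre_digraph list \<Rightarrow> ('a \<times> 'b) pair_pre_digraph"
    (infixl \<open>\<boxtimes>\<close> 70) where
  "Gs \<boxtimes> Hs = \<lparr>
     pverts = (\<Union>(G, H) \<in> set (zip Gs Hs). pverts G \<times> fst ` pverts H),
     parcs = (\<Union>(G, H) \<in> set (zip Gs Hs).
                {((if s then v else u, a), (if s' then v else u, b)) | u v a b s s'.
                   (u, v) \<in> parcs G \<and> ((a, s), (b, s')) \<in> parcs H}) \<rparr>"

text \<open>
  For tree cylinders, the adjacency matrix of the construct is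
  \<open>I \<otimes> B + (\<Sum>i<t. G\<^sub>i \<otimes> E\<^sub>i)\<close>, where \<open>B\<close> is the adjacency matrix of the tree and \<open>E\<^sub>i\<close> has a single
  nonzero entry, at the diagonal position of the \<open>i\<close>th leaf.
\<close>

lemma arcs_cylindrical_construct_tree:
  assumes t: "length Gs = t" and nbr: "\<exists>G\<in>set Gs. \<exists>w. (u, w) \<in> parcs G"
    and gr: "\<And>G. G \<in> set Gs \<Longrightarrow> pair_graph G"
  shows "((u, a), (v, b)) \<in> parcs (Gs \<boxtimes> map (tree_cylinder T h) [0..<t]) \<longleftrightarrow>
           u = v \<and> (a, b) \<in> parcs (tree T h) \<or>
           (\<exists>i<t. (u, v) \<in> parcs (Gs ! i) \<and> a = (h, i) \<and> b = (h, i))" (is "?L \<longleftrightarrow> ?R")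
proof
  have sym: "(y, x) \<in> parcs G" if "G \<in> set Gs" "(x, y) \<in> parcs G" for G x y
  proof -
    interpret pair_graph G by (rule gr) fact
    show ?thesis using that(2) arcs_symmetric by auto
  qed
  have zip: "set (zip Gs (map (tree_cylinder T h) [0..<t])) = {(Gs ! i, tree_cylinder T h i) | i. i < t}"
    using t by (auto simp: set_zip)
  have arcI: "((if s then y else x, c), (if s' then y else x, d))
      \<in> parcs (Gs \<boxtimes> map (tree_cylinder T h) [0..<t])"
    if "i < t" "(x, y) \<in> parcs (Gs ! i)" "((c, s), (d, s')) \<in> parcs (tree_cylinder T h i)"
    for i x y c d s s'
  proof -
    have "(Gs ! i, tree_cylinder T h i) \<in> set (zip Gs (map (tree_cylinder T h) [0..<t]))"
      using that(1) by (auto simp: zip)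
    moreover have "((if s then y else x, c), (if s' then y else x, d)) \<in>
      {((if s then v else u, a), (if s' then v else u, b)) | u v a b s s'.
         (u, v) \<in> parcs (Gs ! i) \<and> ((a, s), (b, s')) \<in> parcs (tree_cylinder T h i)}"
      using that(2,3)
      by (intro CollectI exI[of _ x] exI[of _ y] exI[of _ c] exI[of _ d] exI[of _ s] exI[of _ s']) simp
    ultimately show ?thesis
      unfolding cylindrical_construct_def pair_pre_digraph.simps
      by (intro UN_I) (assumption, simp only: prod.case)
  qed
  {
    assume ?L
    then obtain i x y s s' where i: "i < t" "(x, y) \<in> parcs (Gs ! i)"
        "((a, s), (b, s')) \<in> parcs (tree_cylinder T h i)"
        "u = (if s then y else x)" "v = (if s' then y else x)"
      by (auto simp: cylindrical_construct_def zip)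
    from i have "(y, x) \<in> parcs (Gs ! i)" using sym t by auto
    with i show ?R by (auto simp: tree_cylinder_def)
  }
  {
    assume ?R
    then consider "u = v" "(a, b) \<in> parcs (tree T h)"
      | i where "i < t" "(u, v) \<in> parcs (Gs ! i)" "a = (h, i)" "b = (h, i)" by blast
    then show ?L
    proof cases
      case 1
      from nbr obtain i w where i: "i < t" "(u, w) \<in> parcs (Gs ! i)"
        using t by (auto simp: in_set_conv_nth)
      have "((a, False), (b, False)) \<in> parcs (tree_cylinder T h i)"
        using 1 by (cases a; cases b) (auto simp: tree_cylinder_def)
      from arcI[OF i this] 1 show ?thesis by simp
    next
      case (2 i)
      then have "((a, False), (b, True)) \<in> parcs (tree_cylinder T h i)"
        by (auto simp: tree_cylinder_def)
      from arcI[OF 2(1,2) this] show ?thesis by simp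
    qed
  }
qed

lemma adjacency_cylindrical_construct_tree:
  assumes t: "length Gs = t" and nbr: "\<exists>G\<in>set Gs. \<exists>w. (u, w) \<in> parcs G"
    and gr: "\<And>G. G \<in> set Gs \<Longrightarrow> pair_graph G"
  shows "adjacency (Gs \<boxtimes> map (tree_cylinder T h) [0..<t]) (u, a) (v, b) =
           (if u = v then adjacency (tree T h) a b else 0) +
           (\<Sum>i<t. adjacency (Gs ! i) u v * (if a = (h, i) \<and> b = (h, i) then 1 else 0))"
proof -
  have loop: "(u, u) \<notin> parcs (Gs ! i)" if "i < t" for i
  proof -
    interpret pair_graph "Gs ! i" by (rule gr) (use that t in simp)
    show ?thesis using pair_no_loops[of "(u, u)"] by auto
  qed
  show ?thesis
  proof (cases "\<exists>i<t. a = (h, i) \<and> b = (h, i)")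
    case True
    then obtain i where i: "i < t" "a = (h, i)" "b = (h, i)" by blast
    have "(\<Sum>i'<t. adjacency (Gs ! i') u v * (if a = (h, i') \<and> b = (h, i') then 1 else 0)) =
          (\<Sum>i'<t. if i' = i then adjacency (Gs ! i) u v else 0)"
      by (rule sum.cong) (use i in auto)
    with i loop show ?thesis
      by (auto simp: adjacency_def arcs_cylindrical_construct_tree[OF t nbr gr])
  next
    case False
    then have "(\<Sum>i<t. adjacency (Gs ! i) u v * (if a = (h, i) \<and> b = (h, i) then 1 else 0)) = 0"
      by (intro sum.neutral) auto
    with False show ?thesis
      by (auto simp: adjacency_def arcs_cylindrical_construct_tree[OF t nbr gr])
  qed
qed


text \<open>
  Leaf labels are polynomials; the labels of the other vertices are rational functions, that is,
  elements of \<^typ>\<open>real poly fract\<close>. All labels that are inverted in the intended use, where leaf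
  labels have the form \<open>x - c\<close>, are nonzero.
\<close>

function label :: "tree_kind \<Rightarrow> nat \<Rightarrow> (nat \<Rightarrow> real poly) \<Rightarrow> nat \<Rightarrow> nat \<Rightarrow> real poly fract" where
  "label T h f l i =
     (if l \<ge> h then to_fract (f i)
      else to_fract [:0, 1:] - (\<Sum>j \<in> children T l i. inverse (label T h f (Suc l) j)))"
  by pat_completeness auto
termination by (relation "measure (\<lambda>(T, h, f, l, i). h - l)") auto

declare label.simps [simp del]

definition level_resultant :: "tree_kind \<Rightarrow> nat \<Rightarrow> (nat \<Rightarrow> real poly) \<Rightarrow> nat \<Rightarrow> real poly fract" where
  "level_resultant T h f l = (\<Prod>i<width T l. label T h f l i)"

definition resultant_tree :: "tree_kind \<Rightarrow> nat \<Rightarrow> (nat \<Rightarrow> real poly) \<Rightarrow> real poly fract" where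
  "resultant_tree T h f = (\<Prod>l\<le>h. level_resultant T h f l)"

end

theory Submission
  imports Defs
begin

text \<open>
  The circulants \<open>C\<^sub>n(k\<^sub>i)\<close> are simultaneously diagonalised by the discrete Fourier transform, with
  eigenvalues \<open>2 cos (2\<pi>jk\<^sub>i/n)\<close>. Tensored with the identity on the base tree, this transform turns
  \<open>I \<otimes> B + (\<Sum>i<t. G\<^sub>i \<otimes> E\<^sub>i)\<close> into a block diagonal matrix with blocks \<open>B + \<Theta>\<^sub>j\<close>.

  Eliminating the vertices of the tree from the leaves towards level 0, one obtains the labels as the
  pivots of \<open>x I - B - \<Theta>\<^sub>j\<close>. The determinant is the product of the pivots, except that in the
  unrooted tree the two vertices of level 0, with labels \<open>b\<close> and \<open>c\<close>, are adjacent and contribute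
  \<open>b c - 1\<close> instead of \<open>b c\<close>.
\<close>

section \<open>Determinants over finite index sets\<close>

text \<open>The ring is left arbitrary because determinants are taken over
  \<open>real poly fract\<close> for the elimination and over \<open>complex poly\<close> for the
  Fourier transform.\<close>

definition det_on :: "'a set \<Rightarrow> ('a \<Rightarrow> 'a \<Rightarrow> 'b::comm_ring_1) \<Rightarrow> 'b" where
  "det_on V M = det (mat (card V) (card V) (\<lambda>(i, j). M (from_nat_into V i) (from_nat_into V j)))"

text \<open>Two enumerations differ by a permutation matrix, and conjugating by it does not change
  the determinant.\<close>

lemma det_on_enum:
  assumes V: "finite V" and g: "bij_betw g {..<card V} V"
  shows "det_on V M = det (mat (card V) (card V) (\<lambda>(i, j). M (g i) (g j)))"
proof -
  let ?N = "card V" and ?f = "from_nat_into V"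
  have f: "bij_betw ?f {..<?N} V" using bij_betw_from_nat_into_finite[OF V] .
  \<comment> \<open>\<open>s\<close> is the permutation of the indices with
    \<open>g (s i) = ?f i\<close>.\<close>
  define s where "s = (\<lambda>i. the_inv_into {..<?N} g (?f i))"
  have s: "bij_betw s {..<?N} {..<?N}"
    unfolding s_def using bij_betw_trans[OF f bij_betw_the_inv_into[OF g]] by (simp add: o_def)
  have sN: "s i < ?N" if "i < ?N" for i
    using s that by (auto simp: bij_betw_def)
  have gs: "g (s i) = ?f i" if "i < ?N" for i
    unfolding s_def using g f that
    by (intro f_the_inv_into_f_bij_betw[of g "{..<?N}" V]) (auto simp: bij_betw_def)
  have sinj: "s i = s j \<longleftrightarrow> i = j" if "i < ?N" "j < ?N" for i j
    using s that by (auto simp: bij_betw_def inj_on_def)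
  define P :: "'b mat" where "P = mat ?N ?N (\<lambda>(i, j). if j = s i then 1 else 0)"
  define B where "B = mat ?N ?N (\<lambda>(i, j). M (g i) (g j))"
  have [simp]: "P \<in> carrier_mat ?N ?N" "B \<in> carrier_mat ?N ?N"
    by (simp_all add: P_def B_def)
  have PB: "P * B = mat ?N ?N (\<lambda>(i, j). M (?f i) (g j))"
    by (rule eq_matI)
      (auto simp: P_def B_def scalar_prod_def sN gs if_distrib[of "\<lambda>x. x * _"] cong: if_cong)
  have PBP: "P * B * transpose_mat P = mat ?N ?N (\<lambda>(i, j). M (?f i) (?f j))" unfolding PB
    by (rule eq_matI)
      (auto simp: P_def scalar_prod_def sN gs if_distrib[of "\<lambda>x. _ * x"] cong: if_cong)
  have PP: "P * transpose_mat P = 1\<^sub>m ?N"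
    by (rule eq_matI)
      (auto simp: P_def scalar_prod_def sN sinj if_distrib[of "\<lambda>x. x * _"] cong: if_cong)
  have "det_on V M = det P * det B * det (transpose_mat P)"
    unfolding det_on_def PBP[symmetric]
    by (simp add: det_mult[of _ ?N] mult_carrier_mat[of _ ?N ?N])
  \<comment> \<open>The sign of \<open>s\<close> cancels: the two outer determinants enter only
    through their product, the determinant of \<open>P * transpose_mat P\<close>.\<close>
  also have "\<dots> = det B * det (P * transpose_mat P)"
    by (simp add: det_mult[of _ ?N])
  finally show ?thesis by (simp add: PP B_def)
qed

lemma det_on_cong:
  assumes "finite V" and "\<And>u v. u \<in> V \<Longrightarrow> v \<in> V \<Longrightarrow> M u v = N u v"
  shows "det_on V M = det_on V N"
proof (cases "V = {}")
  case False
  then show ?thesis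
    unfolding det_on_def
    by (intro arg_cong[of _ _ det] eq_matI) (auto intro!: assms(2) from_nat_into)
qed (simp add: det_on_def)

lemma det_on_mult:
  assumes V: "finite V"
  shows "det_on V (\<lambda>u w. \<Sum>v\<in>V. M u v * N v w) = det_on V M * det_on V N"
proof -
  let ?n = "card V" and ?f = "from_nat_into V"
  have "(\<Sum>v\<in>V. F v) = (\<Sum>i<?n. F (?f i))" for F :: "'a \<Rightarrow> 'b"
    using sum.reindex_bij_betw[OF bij_betw_from_nat_into_finite[OF V], of F] by simp
  then have "mat ?n ?n (\<lambda>(i, j). \<Sum>v\<in>V. M (?f i) v * N v (?f j)) =
      mat ?n ?n (\<lambda>(i, j). M (?f i) (?f j)) * mat ?n ?n (\<lambda>(i, j). N (?f i) (?f j))"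
    by (intro eq_matI) (auto simp: scalar_prod_def atLeast0LessThan)
  then show ?thesis
    unfolding det_on_def by (simp add: det_mult[of _ ?n])
qed

lemma det_on_transpose: "det_on V (\<lambda>u v. M v u) = det_on V M"
proof -
  let ?n = "card V" and ?f = "from_nat_into V"
  have "mat ?n ?n (\<lambda>(i, j). M (?f j) (?f i)) = transpose_mat (mat ?n ?n (\<lambda>(i, j). M (?f i) (?f j)))"
    by (intro eq_matI) auto
  then show ?thesis
    unfolding det_on_def by (simp add: det_transpose[of _ ?n])
qed

lemma det_on_image:
  assumes "finite V" "inj_on f V"
  shows "det_on (f ` V) M = det_on V (\<lambda>u v. M (f u) (f v))"
proof -
  have "bij_betw (f \<circ> from_nat_into V) {..<card V} (f ` V)"
    using bij_betw_trans[OF bij_betw_from_nat_into_finite[OF assms(1)] inj_on_imp_bij_betw[OF assms(2)]] .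
  from det_on_enum[OF _ this[folded card_image[OF assms(2)]], of M] show ?thesis
    using assms by (simp add: det_on_def card_image)
qed

lemma (in comm_ring_hom) det_on_hom: "hom (det_on V M) = det_on V (\<lambda>u v. hom (M u v))"
  unfolding det_on_def hom_det[symmetric]
  by (rule arg_cong[of _ _ det]) (auto intro!: eq_matI)

section \<open>Triangular, diagonal and block determinants\<close>

lemma det_on_empty [simp]: "det_on {} M = 1"
  by (simp add: det_on_def)

lemma det_on_singleton [simp]: "det_on {v} M = M v v"
  using from_nat_into[of "{v}" 0] by (simp add: det_on_def det_single)

text \<open>Enumerating \<open>A\<close> before \<open>B\<close> makes the lower left block
  zero.\<close>

lemma det_on_block_triangular:
  fixes M :: "'a \<Rightarrow> 'a \<Rightarrow> 'b::idom"
  assumes A: "finite A" and B: "finite B" and disj: "A \<inter> B = {}"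
    and zero: "\<And>a b. a \<in> A \<Longrightarrow> b \<in> B \<Longrightarrow> M b a = 0"
  shows "det_on (A \<union> B) M = det_on A M * det_on B M"
proof -
  let ?a = "card A" and ?b = "card B" and ?f = "from_nat_into A" and ?h = "from_nat_into B"
  define g where "g i = (if i < ?a then ?f i else ?h (i - ?a))" for i
  have f: "bij_betw ?f {..<?a} A" and h: "bij_betw ?h {..<?b} B"
    by (simp_all add: bij_betw_from_nat_into_finite A B)
  have card: "card (A \<union> B) = ?a + ?b"
    using A B disj by (rule card_Un_disjoint)
  have "bij_betw g {..<?a} A"
    using f by (subst bij_betw_cong[of _ g ?f]) (auto simp: g_def)
  moreover have "bij_betw g {?a..<?a + ?b} B"
  proof -
    have "bij_betw (\<lambda>i. i - ?a) {?a..<?a + ?b} {..<?b}"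
      by (rule bij_betw_byWitness[where f' = "\<lambda>i. i + ?a"]) auto
    from bij_betw_trans[OF this h] show ?thesis
      by (subst bij_betw_cong[of _ g "?h \<circ> (\<lambda>i. i - ?a)"]) (auto simp: g_def)
  qed
  ultimately have "bij_betw g ({..<?a} \<union> {?a..<?a + ?b}) (A \<union> B)"
    using disj by (rule bij_betw_combine)
  moreover have "{..<?a} \<union> {?a..<?a + ?b} = {..<?a + ?b}" by auto
  ultimately have g: "bij_betw g {..<card (A \<union> B)} (A \<union> B)" by (simp add: card)
  have fA: "?f i \<in> A" if "i < ?a" for i using f that by (auto simp: bij_betw_def)
  have hB: "?h i \<in> B" if "i < ?b" for i using h that by (auto simp: bij_betw_def)
  have "mat (?a + ?b) (?a + ?b) (\<lambda>(i, j). M (g i) (g j)) =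
      four_block_mat (mat ?a ?a (\<lambda>(i, j). M (?f i) (?f j))) (mat ?a ?b (\<lambda>(i, j). M (?f i) (?h j)))
        (0\<^sub>m ?b ?a) (mat ?b ?b (\<lambda>(i, j). M (?h i) (?h j)))"
    by (rule eq_matI) (auto simp: g_def intro!: zero fA hB)
  then have "det_on (A \<union> B) M = det (mat ?a ?a (\<lambda>(i, j). M (?f i) (?f j))) *
      det (mat ?b ?b (\<lambda>(i, j). M (?h i) (?h j)))"
    using A B by (simp add: det_on_enum[OF _ g] card det_four_block_mat_lower_left_zero[of _ ?a _ ?b])
  then show ?thesis by (simp add: det_on_def)
qed

text \<open>Induction that adds an element of maximal rank: its row vanishes off the diagonal, so it
  splits off as a 1 by 1 block.\<close>

lemma det_on_upper_triangular:
  fixes M :: "'a \<Rightarrow> 'a \<Rightarrow> 'b::idom" and r :: "'a \<Rightarrow> nat"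
  assumes "finite V" and "\<And>u v. u \<in> V \<Longrightarrow> v \<in> V \<Longrightarrow> u \<noteq> v \<Longrightarrow> r v \<le> r u \<Longrightarrow> M u v = 0"
  shows "det_on V M = (\<Prod>v\<in>V. M v v)"
  using assms
proof (induction V rule: finite_ranking_induct[where f = r])
  case (insert x S)
  show ?case
  proof (cases "x \<in> S")
    \<comment> \<open>The ranking induction may insert an element that is already present.\<close>
    case True
    with insert show ?thesis by (simp add: insert_absorb)
  next
    case False
    have "det_on (S \<union> {x}) M = det_on S M * det_on {x} M"
      by (rule det_on_block_triangular) (use insert False in auto)
    with insert False show ?thesis by (simp add: mult.commute)
  qed
qed simp

lemma det_on_diagonal:
  fixes M :: "'a \<Rightarrow> 'a \<Rightarrow> 'b::idom"
  assumes "finite V" and "\<And>u v. u \<in> V \<Longrightarrow> v \<in> V \<Longrightarrow> u \<noteq> v \<Longrightarrow> M u v = 0"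
  shows "det_on V M = (\<Prod>v\<in>V. M v v)"
  using assms by (intro det_on_upper_triangular[where r = "\<lambda>_. 0"]) auto

text \<open>Serves the block of the two adjacent vertices at level 0 of the unrooted trees. The
  matrix is cut into 1 by 1 blocks, which commute, as the block determinant formula
  requires.\<close>

lemma det_on_pair:
  fixes M :: "'a \<Rightarrow> 'a \<Rightarrow> 'b::idom"
  assumes "a \<noteq> b"
  shows "det_on {a, b} M = M a a * M b b - M a b * M b a"
proof -
  define g where "g i = (if i = (0::nat) then a else b)" for i
  have 2: "{..<card {a, b}} = {0, 1}" using assms by auto
  have g: "bij_betw g {..<card {a, b}} {a, b}"
    unfolding 2 using assms by (auto simp: bij_betw_def g_def)
  define S where "S x = mat 1 1 (\<lambda>_. x)" for x :: 'b
  have S: "S x \<in> carrier_mat 1 1" for x by (simp add: S_def)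
  have mult: "S x * S y = S (x * y)" for x y by (rule eq_matI) (auto simp: S_def scalar_prod_def)
  have minus: "S x - S y = S (x - y)" for x y by (rule eq_matI) (auto simp: S_def)
  have "mat 2 2 (\<lambda>(i, j). M (g i) (g j)) =
      four_block_mat (S (M a a)) (S (M a b)) (S (M b a)) (S (M b b))"
    by (rule eq_matI) (auto simp: S_def g_def)
  then have "det_on {a, b} M =
      det (four_block_mat (S (M a a)) (S (M a b)) (S (M b a)) (S (M b b)))"
    using assms det_on_enum[OF _ g, of M] by (simp add: numeral_2_eq_2)
  also have "\<dots> = M a a * M b b - M a b * M b a"
    using det_single[OF S] by (simp add: det_four_block_mat[OF S S S S] mult minus mult.commute)
      (simp add: S_def)
  finally show ?thesis .
qed

text \<open>One index \<open>i\<close> is split off at a time; its slice of the product is a copy of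
  \<open>V\<close> under \<open>Pair i\<close>.\<close>

lemma det_on_block_diagonal:
  fixes D :: "'j \<Rightarrow> 'a \<Rightarrow> 'a \<Rightarrow> 'b::idom"
  assumes "finite J" and V: "finite V"
  shows "det_on (J \<times> V) (\<lambda>(i, a) (j, b). if i = j then D i a b else 0) = (\<Prod>j\<in>J. det_on V (D j))"
  using assms(1)
proof induction
  case (insert i J)
  let ?M = "\<lambda>(i, a) (j, b). if i = j then D i a b else 0"
  have "det_on (Pair i ` V \<union> J \<times> V) ?M = det_on (Pair i ` V) ?M * det_on (J \<times> V) ?M"
    by (rule det_on_block_triangular) (use insert V in auto)
  also have "Pair i ` V \<union> J \<times> V = insert i J \<times> V" by auto
  also have "det_on (Pair i ` V) ?M = det_on V (D i)"
    using V by (simp add: det_on_image inj_on_def)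
  finally show ?case using insert by simp
qed simp

section \<open>Characteristic polynomials as determinants over index sets\<close>

lemma charpoly_on_eq_det_on:
  assumes "finite V"
  shows "charpoly_on V M = det_on V (\<lambda>u v. (if u = v then [:0, 1:] else 0) - [:M u v:])"
proof -
  have "from_nat_into V i = from_nat_into V j \<longleftrightarrow> i = j" if "i < card V" "j < card V" for i j
    using bij_betw_from_nat_into_finite[OF assms] that by (auto simp: bij_betw_def inj_on_def)
  then show ?thesis
    unfolding charpoly_on_def det_on_def char_poly_defs
    by (intro arg_cong[of _ _ det] eq_matI) auto
qed

lemma charpoly_on_cong:
  assumes "finite V" and "\<And>u v. u \<in> V \<Longrightarrow> v \<in> V \<Longrightarrow> M u v = N u v"
  shows "charpoly_on V M = charpoly_on V N"
  using assms by (simp add: charpoly_on_eq_det_on cong: det_on_cong)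

section \<open>Labels and elimination in trees\<close>

text \<open>
  Labels never vanish because their degree as rational functions is always one: the inverses
  subtracted from \<open>x\<close> in the recursion have negative degree.
\<close>

definition degree_one :: "'a::field poly fract \<Rightarrow> bool" where
  "degree_one z \<longleftrightarrow> (\<exists>p q. z = Fract p q \<and> q \<noteq> 0 \<and> degree p = Suc (degree q))"

definition degree_neg :: "'a::field poly fract \<Rightarrow> bool" where
  "degree_neg z \<longleftrightarrow> (\<exists>p q. z = Fract p q \<and> degree p < degree q)"

lemma degree_one_nonzero: "degree_one z \<Longrightarrow> z \<noteq> 0"
  by (auto simp: degree_one_def Zero_fract_def eq_fract)

lemma degree_neg_inverse: "degree_one z \<Longrightarrow> degree_neg (inverse z)"
  unfolding degree_one_def degree_neg_def by (metis inverse_fract lessI)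

text \<open>Over the common denominator \<open>q * s\<close> both summands of the numerator have
  smaller degree.\<close>

lemma degree_neg_add:
  assumes "degree_neg y" "degree_neg z"
  shows "degree_neg (y + z)"
proof -
  obtain p q where y: "y = Fract p q" "degree p < degree q"
    using assms by (auto simp: degree_neg_def)
  obtain r s where z: "z = Fract r s" "degree r < degree s"
    using assms by (auto simp: degree_neg_def)
  have nz: "q \<noteq> 0" "s \<noteq> 0" using y z by auto
  have "degree (p * s) < degree (q * s)" "degree (r * q) < degree (q * s)"
    using y z nz degree_mult_le[of p s] degree_mult_le[of r q] by (auto simp: degree_mult_eq)
  then have "degree (p * s + r * q) < degree (q * s)"
    by (rule degree_add_less)
  moreover have "y + z = Fract (p * s + r * q) (q * s)"
    using y z nz by simp
  ultimately show ?thesis by (auto simp: degree_neg_def)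
qed

lemma degree_neg_sum:
  fixes f :: "'a \<Rightarrow> 'b::field poly fract"
  assumes "finite A" "\<And>a. a \<in> A \<Longrightarrow> degree_neg (f a)"
  shows "degree_neg (sum f A)"
proof -
  \<comment> \<open>Zero is written as \<open>0 / x\<close>, because the denominator must have
    positive degree.\<close>
  have "degree_neg (0 :: 'b poly fract)"
    unfolding degree_neg_def
    by (intro exI[of _ 0] exI[of _ "[:0, 1:]"]) (simp add: Zero_fract_def eq_fract)
  with assms show ?thesis
    by (induction A rule: finite_induct) (auto intro: degree_neg_add)
qed

text \<open>\<open>x - p / q = (x q - p) / q\<close>, where \<open>x q\<close> is
  \<open>pCons 0 q\<close> and has larger degree than \<open>p\<close>.\<close>

lemma degree_one_diff:
  assumes "degree_neg z"
  shows "degree_one (to_fract [:0, 1:] - z)"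
proof -
  obtain p q where z: "z = Fract p q" "degree p < degree q"
    using assms by (auto simp: degree_neg_def)
  then have q: "q \<noteq> 0" by auto
  have "degree (pCons 0 q - p) = Suc (degree q)"
    using z q degree_add_eq_left[of "-p" "pCons 0 q"] by simp
  moreover have "to_fract [:0, 1:] - z = Fract (pCons 0 q - p) q"
    using z q by (simp add: to_fract_def)
  ultimately show ?thesis using q by (auto simp: degree_one_def)
qed

lemma finite_children [simp]: "finite (children T l i)"
  by (cases "(T, l, i)" rule: children.cases) auto

lemma label_leaf: "label T h f h i = to_fract (f i)"
  by (subst label.simps) simp

lemma label_inner:
  "l < h \<Longrightarrow> label T h f l i =
    to_fract [:0, 1:] - (\<Sum>j \<in> children T l i. inverse (label T h f (Suc l) j))"
  by (subst label.simps) simp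

text \<open>Induction from the leaves towards level 0. It makes every label nonzero, so the inverses
  in the recursion are genuine.\<close>

lemma degree_one_label:
  assumes "\<And>i. degree (f i) = 1" and "l \<le> h"
  shows "degree_one (label T h f l i)"
  using assms(2)
proof (induction l arbitrary: i rule: inc_induct)
  case base
  show ?case
    unfolding label_leaf degree_one_def to_fract_def
    using assms(1) by (intro exI[of _ "f i"] exI[of _ 1]) simp
next
  case (step l)
  then show ?case
    by (auto simp: label_inner intro!: degree_one_diff degree_neg_sum degree_neg_inverse)
qed

section \<open>Levels, parents and arcs of the trees\<close>

lemma tree_verts_Sigma: "tree_verts T h = (SIGMA l:{..h}. {..<width T l})"
  by (auto simp: tree_verts_def)

lemma finite_tree_verts [simp]: "finite (tree_verts T h)"
  by (simp add: tree_verts_Sigma)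

lemma prod_label_tree_verts:
  "(\<Prod>v\<in>tree_verts T h. label T h f (fst v) (snd v)) = resultant_tree T h f"
  unfolding tree_verts_Sigma resultant_tree_def level_resultant_def
  by (subst prod.Sigma) (auto simp: case_prod_beta)

lemma children_less_width:
  assumes "i < width T l" "j \<in> children T l i"
  shows "j < width T (Suc l)"
  using assms by (cases "(T, l, i)" rule: children.cases) auto

text \<open>Parents are unique. The bounds exclude spurious parents at the root of
  \<open>Rooted\<close>, where \<open>children\<close> ignores its index.\<close>

lemma children_inj:
  assumes "j \<in> children T l i" "j \<in> children T l i'" "i < width T l" "i' < width T l"
  shows "i = i'"
  using assms by (cases "(T, l, i)" rule: children.cases; auto; presburger)

lemma down_arcs_verts: "(u, v) \<in> down_arcs T h \<Longrightarrow> u \<in> tree_verts T h \<and> v \<in> tree_verts T h"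
  using children_less_width by (fastforce simp: down_arcs_def tree_verts_def)

lemma down_arcs_level: "(u, v) \<in> down_arcs T h \<Longrightarrow> fst v = Suc (fst u)"
  by (auto simp: down_arcs_def)

lemma down_arcs_unique: "(u, v) \<in> down_arcs T h \<Longrightarrow> (w, v) \<in> down_arcs T h \<Longrightarrow> u = w"
  by (auto simp: down_arcs_def dest: children_inj)

lemma down_arcs_Image:
  "(l, i) \<in> tree_verts T h \<Longrightarrow>
    down_arcs T h `` {(l, i)} = (if l < h then Pair (Suc l) ` children T l i else {})"
  by (auto simp: down_arcs_def tree_verts_def)

lemma level0_arcs_level: "(u, v) \<in> level0_arcs T \<Longrightarrow> fst u = 0 \<and> fst v = 0 \<and> u \<noteq> v"
  by (cases T) auto

text \<open>The label recursion solved for \<open>x\<close>; it yields the diagonal of the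
  factorization below. At a leaf the sum is empty and the leaf label remains.\<close>

lemma label_plus_inverse_children:
  assumes "(l, i) \<in> tree_verts T h"
  shows "label T h f l i + (\<Sum>v\<in>down_arcs T h `` {(l, i)}. inverse (label T h f (fst v) (snd v))) =
    to_fract (if l = h then f i else [:0, 1:])"
proof (cases "l < h")
  case True
  then show ?thesis
    using assms by (simp add: down_arcs_Image sum.reindex inj_on_def label_inner)
next
  case False
  then show ?thesis
    using assms by (subst down_arcs_Image) (auto simp: label_leaf tree_verts_def)
qed

definition label_diag ::
    "tree_kind \<Rightarrow> nat \<Rightarrow> (nat \<Rightarrow> real poly) \<Rightarrow> nat \<times> nat \<Rightarrow> nat \<times> nat \<Rightarrow> real poly fract" where
  "label_diag T h f u v =
    (if u = v then label T h f (fst u) (snd u) else 0) - (if (u, v) \<in> level0_arcs T then 1 else 0)"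

definition label_upper ::
    "tree_kind \<Rightarrow> nat \<Rightarrow> (nat \<Rightarrow> real poly) \<Rightarrow> nat \<times> nat \<Rightarrow> nat \<times> nat \<Rightarrow> real poly fract" where
  "label_upper T h f u v =
    (if u = v then 1 else 0) -
    (if (u, v) \<in> down_arcs T h then inverse (label T h f (fst v) (snd v)) else 0)"

text \<open>
  With \<open>U\<close> = \<^const>\<open>label_upper\<close> and \<open>D\<close> = \<^const>\<open>label_diag\<close>, the characteristic matrix of the tree with
  weighted leaves is \<open>U D U\<^sup>T\<close> (lemma \<open>label_factorization\<close>). For \<^const>\<open>Unrooted\<close>, \<open>D\<close> is not diagonal: the
  edge of level 0 stays in it as a \<open>2 \<times> 2\<close> block.
\<close>

lemma det_on_label_upper: "det_on (tree_verts T h) (label_upper T h f) = 1"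
proof -
  have irr: "(v, v) \<notin> down_arcs T h" for v
    using down_arcs_level[of v v T h] by auto
  \<comment> \<open>Downward arcs raise the level, so the matrix is unitriangular with respect to
    \<open>fst\<close>.\<close>
  have "det_on (tree_verts T h) (label_upper T h f) = (\<Prod>v\<in>tree_verts T h. label_upper T h f v v)"
    by (rule det_on_upper_triangular[where r = fst]) (auto simp: label_upper_def dest: down_arcs_level)
  then show ?thesis by (simp add: label_upper_def irr)
qed

text \<open>On the diagonal, the label of \<open>u\<close> is completed by the inverse labels of its
  children. On a downward arc the label of the child cancels its inverse, leaving \<open>-1\<close>.
  Distinct vertices have no common child, so elimination produces no further entries.\<close>

lemma label_factorization:
  assumes f: "\<And>i. degree (f i) = 1" and u: "u \<in> tree_verts T h" and w: "w \<in> tree_verts T h"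
  shows "(\<Sum>v\<in>tree_verts T h. (\<Sum>v'\<in>tree_verts T h. label_upper T h f u v' * label_diag T h f v' v)
            * label_upper T h f w v) =
    to_fract (if u = w then (if fst u = h then f (snd u) else [:0, 1:]) else 0) -
    (if (u, w) \<in> parcs (tree T h) then 1 else 0)"
proof -
  let ?V = "tree_verts T h" and ?D = "down_arcs T h" and ?E = "level0_arcs T"
  let ?U = "label_upper T h f"
  define L where "L v = label T h f (fst v) (snd v)" for v
  have L0: "L v \<noteq> 0" if "v \<in> ?V" for v
    unfolding L_def using that by (intro degree_one_nonzero degree_one_label f) (auto simp: tree_verts_def)
  have U: "?U a b = (if a = b then 1 else 0) - (if (a, b) \<in> ?D then inverse (L b) else 0)" for a b
    by (simp add: label_upper_def L_def)
  have Dg: "label_diag T h f a b = (if a = b then L b else 0) - (if (a, b) \<in> ?E then 1 else 0)" for a b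
    by (simp add: label_diag_def L_def)
  \<comment> \<open>No downward arc ends at level 0, so these columns of \<open>U\<close> are unit
    vectors and the edge of level 0 passes unchanged through both multiplications.\<close>
  have U0: "?U a b = (if a = b then 1 else 0)" if "fst b = 0" for a b
    using that by (auto simp: U dest: down_arcs_level)
  have E: "(\<Sum>v'\<in>?V. ?U u v' * (if (v', v) \<in> ?E then 1 else 0)) = (if (u, v) \<in> ?E then 1 else 0)" for v
  proof -
    have "(\<Sum>v'\<in>?V. ?U u v' * (if (v', v) \<in> ?E then 1 else 0)) =
        (\<Sum>v'\<in>?V. if v' = u then (if (u, v) \<in> ?E then 1 else 0) else 0)"
      by (rule sum.cong) (auto simp: U0 dest: level0_arcs_level)
    with u show ?thesis by simp
  qed
  have UD: "(\<Sum>v'\<in>?V. ?U u v' * label_diag T h f v' v) = ?U u v * L v - (if (u, v) \<in> ?E then 1 else 0)"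
    if "v \<in> ?V" for v
    using that by (simp add: Dg right_diff_distrib sum_subtractf E if_distrib[of "\<lambda>x. _ * x"] cong: if_cong)
      (simp add: E[simplified if_distrib[of "\<lambda>x. _ * x"] mult_1_right mult_zero_right])
  have E': "(\<Sum>v\<in>?V. (if (u, v) \<in> ?E then 1 else 0) * ?U w v) = (if (u, w) \<in> ?E then 1 else 0)"
  proof -
    have "(\<Sum>v\<in>?V. (if (u, v) \<in> ?E then 1 else 0) * ?U w v) =
        (\<Sum>v\<in>?V. if v = w then (if (u, w) \<in> ?E then 1 else 0) else 0)"
      by (rule sum.cong) (auto simp: U0 dest: level0_arcs_level)
    with w show ?thesis by simp
  qed
  have UL: "?U u v * L v * ?U w v = (if v = u then L u * ?U w u else 0) - (if (u, v) \<in> ?D then ?U w v else 0)"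
    if "v \<in> ?V" for v
    using L0[OF that] down_arcs_level[of u u] by (auto simp: U[of u] left_diff_distrib)
  have irr: "(v, v) \<notin> ?D" for v
    using down_arcs_level[of v v T h] by auto
  \<comment> \<open>The levels keep the three kinds of arcs apart, so that their 0/1 terms add up to
    a single indicator of the arcs of the tree.\<close>
  have disj: "(u, w) \<in> ?D \<Longrightarrow> (w, u) \<notin> ?D" "(u, w) \<in> ?D \<union> ?D\<inverse> \<Longrightarrow> (u, w) \<notin> ?E"
    "(u, w) \<in> ?E \<Longrightarrow> u \<noteq> w"
    using down_arcs_level[of u w T h] down_arcs_level[of w u T h] level0_arcs_level[of u w T] by auto
  have sub: "?D `` {u} \<subseteq> ?V" using down_arcs_verts by blast
  then have fin: "finite (?D `` {u})" by (rule finite_subset) simp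
  have "(\<Sum>v\<in>?V. if (u, v) \<in> ?D then ?U w v else 0) = (\<Sum>v\<in>?D `` {u}. ?U w v)"
    using sub by (intro sum.mono_neutral_cong_right) auto
  \<comment> \<open>A child \<open>v\<close> of \<open>u\<close> contributes an inverse label to row
    \<open>w\<close> only if \<open>w\<close> is its parent, that is, \<open>w = u\<close>.\<close>
  also have "\<dots> = (\<Sum>v\<in>?D `` {u}. (if v = w then 1 else 0) - (if u = w then inverse (L v) else 0))"
    by (rule sum.cong) (auto simp: U dest: down_arcs_unique)
  also have "\<dots> = (if (u, w) \<in> ?D then 1 else 0) - (if u = w then \<Sum>v\<in>?D `` {u}. inverse (L v) else 0)"
    using fin by (simp add: sum_subtractf)
  finally have S2: "(\<Sum>v\<in>?V. if (u, v) \<in> ?D then ?U w v else 0) = \<dots>" .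
  have S1: "L u * ?U w u = (if u = w then L u else 0) - (if (w, u) \<in> ?D then 1 else 0)"
    using L0[OF u] by (auto simp: U irr)
  have LS: "L u + (\<Sum>v\<in>?D `` {u}. inverse (L v)) = to_fract (if fst u = h then f (snd u) else [:0, 1:])"
    using label_plus_inverse_children[of "fst u" "snd u" T h f] u by (simp add: L_def)
  have "(\<Sum>v\<in>?V. (\<Sum>v'\<in>?V. ?U u v' * label_diag T h f v' v) * ?U w v) =
      (\<Sum>v\<in>?V. ?U u v * L v * ?U w v - (if (u, v) \<in> ?E then 1 else 0) * ?U w v)"
    by (rule sum.cong) (simp_all only: UD left_diff_distrib)
  also have "\<dots> = (\<Sum>v\<in>?V. ?U u v * L v * ?U w v) - (if (u, w) \<in> ?E then 1 else 0)"
    by (simp only: sum_subtractf E')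
  also have "(\<Sum>v\<in>?V. ?U u v * L v * ?U w v) =
      (\<Sum>v\<in>?V. (if v = u then L u * ?U w u else 0) - (if (u, v) \<in> ?D then ?U w v else 0))"
    by (rule sum.cong) (simp_all only: UL)
  also have "\<dots> = (if u = w then L u + (\<Sum>v\<in>?D `` {u}. inverse (L v)) else 0) -
      (if (w, u) \<in> ?D then 1 else 0) - (if (u, w) \<in> ?D then 1 else 0)"
    using u by (simp add: sum_subtractf S2 S1)
  also have "\<dots> - (if (u, w) \<in> ?E then 1 else 0) =
      to_fract (if u = w then (if fst u = h then f (snd u) else [:0, 1:]) else 0) -
      (if (u, w) \<in> parcs (tree T h) then 1 else 0)"
    unfolding LS using disj irr by (auto simp: tree_def)
  finally show ?thesis .
qed

interpretation to_fract_hom: comm_ring_hom to_fract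
  by unfold_locales auto

text \<open>In the factorization \<open>U D U^T\<close> over the fraction field both outer factors
  have determinant 1.\<close>

lemma charpoly_on_tree:
  fixes d :: "nat \<Rightarrow> real"
  defines "f \<equiv> \<lambda>i. [:- d i, 1:]"
  shows "to_fract (charpoly_on (tree_verts T h)
      (\<lambda>u v. adjacency (tree T h) u v + leaf_diag h d u v)) =
    det_on (tree_verts T h) (label_diag T h f)"
proof -
  let ?V = "tree_verts T h"
  let ?M = "\<lambda>u v. adjacency (tree T h) u v + leaf_diag h d u v"
  let ?U = "label_upper T h f" and ?D = "label_diag T h f"
  have "to_fract (charpoly_on ?V ?M) =
      det_on ?V (\<lambda>u v. to_fract ((if u = v then [:0, 1:] else 0) - [:?M u v:]))"
    by (simp only: charpoly_on_eq_det_on finite_tree_verts to_fract_hom.det_on_hom)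
  also have "\<dots> = det_on ?V (\<lambda>u w. \<Sum>v\<in>?V. (\<Sum>v'\<in>?V. ?U u v' * ?D v' v) * ?U w v)"
  proof (rule det_on_cong)
    fix u w assume uw: "u \<in> ?V" "w \<in> ?V"
    have "to_fract ((if u = w then [:0, 1:] else 0) - [:?M u w:]) =
        to_fract ((if u = w then (if fst u = h then f (snd u) else [:0, 1:]) else 0) -
          (if (u, w) \<in> parcs (tree T h) then 1 else 0))"
      by (rule arg_cong[of _ _ to_fract]) (auto simp: adjacency_def leaf_diag_def f_def one_pCons)
    also have "\<dots> = (\<Sum>v\<in>?V. (\<Sum>v'\<in>?V. ?U u v' * ?D v' v) * ?U w v)"
      by (subst label_factorization[OF _ uw]) (auto simp: f_def)
    finally show "to_fract ((if u = w then [:0, 1:] else 0) - [:?M u w:]) = \<dots>" .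
  qed simp
  also have "\<dots> = det_on ?V ?U * det_on ?V ?D * det_on ?V ?U"
    using det_on_transpose[of ?V ?U] by (simp add: det_on_mult[where N = "\<lambda>v w. ?U w v"] det_on_mult)
  finally show ?thesis by (simp add: det_on_label_upper)
qed

text \<open>Without arcs inside level 0 the pivot matrix is diagonal.\<close>

lemma det_on_label_diag_Rooted:
  "det_on (tree_verts Rooted h) (label_diag Rooted h f) = resultant_tree Rooted h f"
  unfolding prod_label_tree_verts[symmetric]
  by (subst det_on_diagonal) (auto simp: label_diag_def)

text \<open>The two vertices of level 0 form a block of determinant \<open>b c - 1\<close>; the
  remaining pivots are diagonal. The quotient replaces the factor \<open>b c\<close> of the
  resultant by \<open>b c - 1\<close>.\<close>

lemma det_on_label_diag_Unrooted:
  assumes f: "\<And>i. degree (f i) = 1"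
  shows "det_on (tree_verts Unrooted h) (label_diag Unrooted h f) =
    resultant_tree Unrooted h f *
      ((level_resultant Unrooted h f 0 - 1) / level_resultant Unrooted h f 0)"
proof -
  let ?V = "tree_verts Unrooted h" and ?R = "level_resultant Unrooted h f 0"
  let ?A = "{(0::nat, 0::nat), (0, 1)}"
  let ?M = "label_diag Unrooted h f" and ?L = "\<lambda>v. label Unrooted h f (fst v) (snd v)"
  have VA: "?V = ?A \<union> (?V - ?A)" by (auto simp: tree_verts_def)
  have "{..<2} = {0, 1::nat}" by auto
  then have R: "?R = ?L (0, 0) * ?L (0, 1)" by (simp add: level_resultant_def)
  \<comment> \<open>Needed to cancel the denominator at the end.\<close>
  have R0: "?R \<noteq> 0"
    using f by (auto simp: R intro!: degree_one_nonzero degree_one_label)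
  have "det_on ?V ?M = det_on ?A ?M * det_on (?V - ?A) ?M"
    by (subst VA, rule det_on_block_triangular) (auto simp: label_diag_def)
  also have "det_on ?A ?M = ?R - 1"
    by (simp add: det_on_pair R label_diag_def)
  also have "det_on (?V - ?A) ?M = (\<Prod>v\<in>?V - ?A. ?L v)"
    by (subst det_on_diagonal) (auto simp: label_diag_def intro!: prod.cong)
  finally have *: "det_on ?V ?M = (?R - 1) * (\<Prod>v\<in>?V - ?A. ?L v)" .
  have "resultant_tree Unrooted h f = (\<Prod>v\<in>?V - ?A. ?L v) * prod ?L ?A"
    unfolding prod_label_tree_verts[symmetric]
    using VA by (intro prod.subset_diff) auto
  also have "prod ?L ?A = ?R" by (simp add: R)
  finally show ?thesis using R0 by (simp add: *)
qed

section \<open>Circulant graphs and the Fourier transform\<close>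

text \<open>The bound \<open>2 * k < int n\<close> keeps the neighbours \<open>u + k\<close> and
  \<open>u - k\<close> distinct: otherwise \<open>n\<close> would divide
  \<open>2 * k\<close>.\<close>

lemma circulant_arcs:
  assumes "1 \<le> k" "2 * k < int n" "u < n"
  defines "p \<equiv> nat ((int u + k) mod int n)" and "m \<equiv> nat ((int u - k) mod int n)"
  shows "{v. (u, v) \<in> parcs (circulant n k)} = {p, m}" "p \<noteq> m" "p < n" "m < n"
proof -
  have n: "int n > 0" using assms by simp
  have p: "int p = (int u + k) mod int n" and m: "int m = (int u - k) mod int n"
    using n by (simp_all add: p_def m_def)
  show pn: "p < n" and mn: "m < n"
    using n p m pos_mod_bound[OF n] by (metis of_nat_less_iff)+
  show "p \<noteq> m"
  proof
    assume "p = m"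
    with p m have "[int u + k = int u - k] (mod int n)" by (simp add: cong_def)
    then have "int n dvd 2 * k" by (simp add: cong_iff_dvd_diff)
    then show False using assms by (simp add: zdvd_not_zless)
  qed
  have "[int v = int u + k] (mod int n) \<longleftrightarrow> v = p" if "v < n" for v
    using that by (auto simp: cong_def p[symmetric])
  moreover have "[int u = int v + k] (mod int n) \<longleftrightarrow> v = m" if "v < n" for v
  proof -
    have "[int u = int v + k] (mod int n) \<longleftrightarrow> [int v = int u - k] (mod int n)"
      unfolding cong_iff_dvd_diff by (subst dvd_minus_iff[symmetric]) (simp add: algebra_simps)
    with that show ?thesis by (auto simp: cong_def m[symmetric])
  qed
  ultimately show "{v. (u, v) \<in> parcs (circulant n k)} = {p, m}"
    using assms(3) pn mn by (auto simp: circulant_def)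
qed

section \<open>Characters of the cyclic group: eigenvectors and orthogonality\<close>

lemma cis_cong_mod:
  assumes "[a = b] (mod int n)"
  shows "cis (2 * pi * real j * of_int a / real n) = cis (2 * pi * real j * of_int b / real n)"
\<comment> \<open>For \<open>n = 0\<close> both angles are quotients by zero, hence 0.\<close>
proof (cases "n = 0")
  case False
  from assms obtain c where "b = a + int n * c" by (auto simp: cong_iff_lin)
  then have "2 * pi * real j * of_int b / real n =
      2 * pi * real j * of_int a / real n + 2 * pi * of_int (int j * c)"
    using False by (simp add: field_simps)
  then show ?thesis
    by (simp only: cis_mult[symmetric] cis_multiple_2pi Ints_of_int mult_1_right)
qed simp

text \<open>The two neighbours of \<open>u\<close> multiply the character by
  \<open>cis c + cis (- c) = 2 cos c\<close>.\<close>

lemma circulant_eigenvector: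
  assumes "1 \<le> k" "2 * k < int n" "u < n"
  shows "(\<Sum>v<n. of_real (adjacency (circulant n k) u v) * cis (2 * pi * real j * real v / real n)) =
    of_real (2 * cos (2 * pi * real j * of_int k / real n)) * cis (2 * pi * real j * real u / real n)"
proof -
  let ?e = "\<lambda>a::int. cis (2 * pi * real j * of_int a / real n)"
  let ?c = "2 * pi * real j * of_int k / real n"
  define p m where "p = nat ((int u + k) mod int n)" and "m = nat ((int u - k) mod int n)"
  note arcs = circulant_arcs[OF assms, folded p_def m_def]
  have "int n > 0" using assms by simp
  then have cong: "[int p = int u + k] (mod int n)" "[int m = int u - k] (mod int n)"
    by (simp_all add: p_def m_def cong_def)
  have "(\<Sum>v<n. of_real (adjacency (circulant n k) u v) * cis (2 * pi * real j * real v / real n)) =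
      (\<Sum>v\<in>{v. (u, v) \<in> parcs (circulant n k)}. ?e (int v))"
    by (rule sum.mono_neutral_cong_right) (auto simp: adjacency_def circulant_def)
  also have "\<dots> = ?e (int u + k) + ?e (int u - k)"
    using arcs(2) by (simp only: arcs(1) cis_cong_mod[OF cong(1), symmetric] cis_cong_mod[OF cong(2), symmetric]) simp
  also have "\<dots> = (cis ?c + cis (- ?c)) * ?e (int u)"
    by (simp add: distrib_right cis_mult add_divide_distrib diff_divide_distrib algebra_simps)
  also have "cis ?c + cis (- ?c) = of_real (2 * cos ?c)"
    by (simp add: complex_eq_iff)
  finally show ?thesis by simp
qed

text \<open>A geometric sum whose ratio \<open>z\<close> is an \<open>n\<close>th root of unity,
  different from 1 unless \<open>u = v\<close>.\<close>

lemma sum_cis_orthogonal: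
  assumes "u < n" "v < n"
  shows "(\<Sum>j<n. cis (2 * pi * real j * real u / real n) * cis (- (2 * pi * real j * real v / real n))) =
    (if u = v then of_nat n else 0)"
proof -
  define z where "z = cis (2 * pi * (real u - real v) / real n)"
  have "cis (2 * pi * real j * real u / real n) * cis (- (2 * pi * real j * real v / real n)) = z ^ j" for j
    unfolding z_def by (simp add: cis_mult DeMoivre right_diff_distrib diff_divide_distrib mult.commute mult.left_commute)
  then have sum: "(\<Sum>j<n. cis (2 * pi * real j * real u / real n) *
      cis (- (2 * pi * real j * real v / real n))) = (\<Sum>j<n. z ^ j)"
    by simp
  show ?thesis
  proof (cases "u = v")
    case False
    have zn: "z ^ n = 1"
    proof -
      have "real n * (2 * pi * (real u - real v) / real n) = 2 * pi * of_int (int u - int v)"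
        using assms by simp
      then show ?thesis
        by (simp only: z_def DeMoivre cis_multiple_2pi Ints_of_int)
    qed
    \<comment> \<open>\<open>z = 1\<close> would make \<open>n\<close> divide \<open>u - v\<close>,
      impossible for distinct numbers below \<open>n\<close>.\<close>
    have "z \<noteq> 1"
    proof
      assume "z = 1"
      then obtain c :: int where "2 * pi * (real u - real v) / real n = of_int c * (2 * pi)"
        by (auto simp: z_def complex_eq_iff cos_one_2pi_int mult.commute mult.left_commute)
      then have "2 * pi * (real u - real v) = 2 * pi * (of_int c * real n)"
        using assms by (simp add: field_simps)
      then have "real u - real v = of_int c * real n"
        by (subst (asm) mult_left_cancel) simp_all
      then have "real_of_int (int u - int v) = real_of_int (c * int n)"
        by simp
      then have "int u - int v = c * int n"
        by (simp only: of_int_eq_iff)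
      then have "[int u = int v] (mod int n)"
        by (simp add: cong_iff_dvd_diff)
      with assms False show False
        by (simp add: cong_def)
    qed
    with zn geometric_sum[of z n] False show ?thesis by (simp add: sum)
  qed (simp add: cis_mult)
qed

text \<open>The Fourier matrix is complex; injectivity of this embedding lets the final identity be
  read back in \<open>real poly\<close>.\<close>

interpretation cpoly: map_poly_inj_idom_hom "of_real :: real \<Rightarrow> complex" ..

text \<open>The transform acts on the first coordinate only, so it commutes with arbitrary
  \<open>B\<close> and \<open>E i\<close>. From \<open>N P = P BD\<close> the factor
  \<open>det P\<close> is cancelled.\<close>

lemma charpoly_on_circulant_sum:
  fixes B :: "'a \<Rightarrow> 'a \<Rightarrow> real" and E :: "nat \<Rightarrow> 'a \<Rightarrow> 'a \<Rightarrow> real"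
  assumes V: "finite V" and k: "\<And>i. i < t \<Longrightarrow> 1 \<le> k i \<and> 2 * k i < int n"
  shows "charpoly_on ({..<n} \<times> V) (\<lambda>(u, a) (v, b). (if u = v then B a b else 0) +
      (\<Sum>i<t. adjacency (circulant n (k i)) u v * E i a b)) =
    (\<Prod>j<n. charpoly_on V (\<lambda>a b. B a b +
      (\<Sum>i<t. 2 * cos (2 * pi * real j * of_int (k i) / real n) * E i a b)))"
    (is "charpoly_on ?W ?M = (\<Prod>j<n. charpoly_on V (?D j))")
proof -
  let ?h = "map_poly (of_real :: real \<Rightarrow> complex)"
  define e where "e u j = cis (2 * pi * real j * real u / real n)" for u j
  define N where "N = (\<lambda>x y. ?h ((if x = y then [:0, 1:] else 0) - [:?M x y:]))"
  define D where "D = (\<lambda>j a b. ?h ((if a = b then [:0, 1:] else 0) - [:?D j a b:]))"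
  define P where "P = (\<lambda>(u, a) (j, b :: 'a). if a = b then [:e u j:] else 0)"
  define Q where "Q = (\<lambda>(j, a) (v, b :: 'a). if a = b then [:cis (- (2 * pi * real j * real v / real n)):] else 0)"
  define BD where "BD = (\<lambda>(i, a) (j, b). if i = j then D i a b else 0)"
  have const: "?h [:r:] = [:of_real r:]" for r
    by (rule poly_eqI) (simp add: coeff_map_poly coeff_pCons split: nat.splits)
  have W: "finite ?W" using V by simp
  have sumW: "(\<Sum>x\<in>?W. F x) = (\<Sum>v<n. \<Sum>c\<in>V. F (v, c))" for F :: "nat \<times> 'a \<Rightarrow> complex poly"
    using V by (simp add: sum.cartesian_product)
  \<comment> \<open>\<open>P\<close> is the discrete Fourier transform along the cycle, with inverse \<open>Q / n\<close>; it conjugates \<open>N\<close>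
    to the block diagonal matrix \<open>BD\<close>.\<close>
  have NP: "(\<Sum>y\<in>?W. N x y * P y z) = (\<Sum>y\<in>?W. P x y * BD y z)" if xz: "x \<in> ?W" "z \<in> ?W" for x z
  proof -
    obtain u a j b where [simp]: "x = (u, a)" "z = (j, b)" by (cases x; cases z)
    with xz have u: "u < n" "j < n" and ab: "a \<in> V" "b \<in> V" by auto
    have Nsplit: "N (u, a) (v, b) = (if v = u then ?h ((if a = b then [:0, 1:] else 0) - [:B a b:]) else 0)
        - [:\<Sum>i<t. of_real (adjacency (circulant n (k i)) u v) * of_real (E i a b):]" for v
      by (auto simp: N_def cpoly.hom_minus const)
    have "(\<Sum>y\<in>?W. N x y * P y z) = (\<Sum>v<n. N (u, a) (v, b) * [:e v j:])"
      using V ab by (simp add: sumW P_def if_distrib[of "\<lambda>x. _ * x"] cong: if_cong)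
    also have "\<dots> = (\<Sum>v<n. (if v = u then ?h ((if a = b then [:0, 1:] else 0) - [:B a b:]) * [:e u j:] else 0)
        - [:\<Sum>i<t. of_real (E i a b) * (of_real (adjacency (circulant n (k i)) u v) * e v j):])"
      unfolding Nsplit left_diff_distrib
      by (rule sum.cong) (auto simp: sum_distrib_right sum_distrib_left mult_ac)
    also have "\<dots> = ?h ((if a = b then [:0, 1:] else 0) - [:B a b:]) * [:e u j:]
        - [:\<Sum>v<n. \<Sum>i<t. of_real (E i a b) * (of_real (adjacency (circulant n (k i)) u v) * e v j):]"
      using u by (simp add: sum_subtractf sum_to_poly)
    \<comment> \<open>After exchanging the sums, the eigenvector identity applies to each circulant
      separately.\<close>
    also have "(\<Sum>v<n. \<Sum>i<t. of_real (E i a b) * (of_real (adjacency (circulant n (k i)) u v) * e v j)) =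
        (\<Sum>i<t. of_real (E i a b) * (of_real (2 * cos (2 * pi * real j * of_int (k i) / real n)) * e u j))"
      unfolding e_def
      by (subst sum.swap) (intro sum.cong refl, simp only: sum_distrib_left[symmetric],
        subst circulant_eigenvector, use k u in auto)
    also have "?h ((if a = b then [:0, 1:] else 0) - [:B a b:]) * [:e u j:] - [:\<dots>:] = [:e u j:] * D j a b"
      by (simp add: D_def cpoly.hom_minus const algebra_simps sum_distrib_left sum_distrib_right)
    also have "\<dots> = (\<Sum>y\<in>?W. P x y * BD y z)"
    proof -
      have "(\<Sum>y\<in>?W. P x y * BD y z) = (\<Sum>i<n. \<Sum>c\<in>V. if c = a then (if i = j then [:e u j:] * D j a b else 0) else 0)"
        by (simp only: sumW) (intro sum.cong refl, auto simp: P_def BD_def)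
      with V ab u show ?thesis by simp
    qed
    finally show ?thesis .
  qed
  have PQ: "(\<Sum>y\<in>?W. P x y * Q y z) = (if x = z then [:of_nat n:] else 0)" if xz: "x \<in> ?W" "z \<in> ?W" for x z
  proof -
    obtain u a v b where [simp]: "x = (u, a)" "z = (v, b)" by (cases x; cases z)
    with xz have u: "u < n" "v < n" and ab: "a \<in> V" "b \<in> V" by auto
    have "(\<Sum>y\<in>?W. P x y * Q y z) = (\<Sum>j<n. \<Sum>c\<in>V. if c = a then
        (if a = b then [:e u j * cis (- (2 * pi * real j * real v / real n)):] else 0) else 0)"
      by (simp only: sumW) (intro sum.cong refl, auto simp: P_def Q_def)
    also have "\<dots> = (if a = b then [:\<Sum>j<n. e u j * cis (- (2 * pi * real j * real v / real n)):] else 0)"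
      using V ab by (simp add: sum_to_poly)
    finally show ?thesis
      unfolding e_def sum_cis_orthogonal[OF u] by auto
  qed
  \<comment> \<open>\<open>P Q\<close> is \<open>n\<close> times the identity, so
    \<open>det P\<close> divides a power of \<open>n\<close>.\<close>
  have "det_on ?W P * det_on ?W Q = det_on ?W (\<lambda>x z. if x = z then [:of_nat n:] else 0)"
    unfolding det_on_mult[OF W, symmetric] by (rule det_on_cong[OF W PQ])
  also have "\<dots> = (\<Prod>x\<in>?W. [:of_nat n:])"
    by (subst det_on_diagonal[OF W]) auto
  finally have "det_on ?W P * det_on ?W Q = (\<Prod>x\<in>?W. [:of_nat n:])" .
  \<comment> \<open>For \<open>n = 0\<close> the index set is empty and the product is 1.\<close>
  moreover have "(\<Prod>x\<in>?W. [:of_nat n :: complex:]) \<noteq> 0"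
    using W by (cases "n = 0") auto
  ultimately have P0: "det_on ?W P \<noteq> 0" by auto
  have "det_on ?W N * det_on ?W P = det_on ?W P * det_on ?W BD"
    unfolding det_on_mult[OF W, symmetric] by (rule det_on_cong[OF W NP])
  with P0 have "det_on ?W N = det_on ?W BD" by simp
  also have "\<dots> = (\<Prod>j<n. det_on V (D j))"
    unfolding BD_def using V by (simp add: det_on_block_diagonal)
  finally have "?h (charpoly_on ?W ?M) = ?h (\<Prod>j<n. charpoly_on V (?D j))"
    using V W by (simp only: charpoly_on_eq_det_on cpoly.det_on_hom cpoly.hom_prod N_def D_def)
  then show ?thesis by simp
qed

text \<open>The construct has the Kronecker form treated above, with \<open>E i\<close> the matrix
  unit of the \<open>i\<close>th leaf; weighting these units by the eigenvalues gives
  \<open>leaf_diag\<close>.\<close>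

lemma graph_charpoly_tree_cylinders:
  fixes k :: "nat \<Rightarrow> int"
  assumes t: "t = width T h" "t \<ge> 1" and k: "\<And>i. i < t \<Longrightarrow> 1 \<le> k i \<and> 2 * k i < int n"
  shows "graph_charpoly (map (\<lambda>i. circulant n (k i)) [0..<t] \<boxtimes> map (tree_cylinder T h) [0..<t]) =
    (\<Prod>j=1..n. charpoly_on (tree_verts T h) (\<lambda>u v. adjacency (tree T h) u v +
      leaf_diag h (\<lambda>i. 2 * cos (2 * pi * real j * of_int (k i) / real n)) u v))"
proof -
  let ?Cs = "map (\<lambda>i. circulant n (k i)) [0..<t]"
  let ?V = "tree_verts T h"
  let ?\<theta> = "\<lambda>j i. 2 * cos (2 * pi * real j * of_int (k i) / real n)"
  let ?E = "\<lambda>i a b. if a = (h, i) \<and> b = (h, i) then 1 else 0 :: real"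
  define F where "F j = charpoly_on ?V (\<lambda>u v. adjacency (tree T h) u v + leaf_diag h (?\<theta> j) u v)" for j
  have "zip ?Cs (map (tree_cylinder T h) [0..<t]) =
      map (\<lambda>i. (circulant n (k i), tree_cylinder T h i)) [0..<t]"
    by (simp add: zip_map_map zip_same_conv_map)
  then have verts: "pverts (?Cs \<boxtimes> map (tree_cylinder T h) [0..<t]) = {..<n} \<times> ?V"
    using t(2) by (auto simp: cylindrical_construct_def tree_cylinder_def circulant_def)
  have gr: "pair_graph G" if "G \<in> set ?Cs" for G
    using that k by (fastforce intro!: pair_graph_circulant)
  \<comment> \<open>Copies of the base enter the construct only through arcs of the circulants, so
    every \<open>u\<close> must have a neighbour; \<open>k 0\<close> provides one.\<close>
  have nbr: "\<exists>G\<in>set ?Cs. \<exists>w. (u, w) \<in> parcs G" if "u < n" for u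
    using circulant_arcs(1)[of "k 0" n u] k[of 0] t(2) that by fastforce
  have "graph_charpoly (?Cs \<boxtimes> map (tree_cylinder T h) [0..<t]) =
      charpoly_on ({..<n} \<times> ?V) (\<lambda>(u, a) (v, b). (if u = v then adjacency (tree T h) a b else 0) +
        (\<Sum>i<t. adjacency (circulant n (k i)) u v * ?E i a b))"
    unfolding graph_charpoly_def verts
  proof (rule charpoly_on_cong)
    fix x y assume "x \<in> {..<n} \<times> ?V" "y \<in> {..<n} \<times> ?V"
    then obtain u a v b where xy: "x = (u, a)" "y = (v, b)" "u < n" by auto
    show "adjacency (?Cs \<boxtimes> map (tree_cylinder T h) [0..<t]) x y =
        (case x of (u, a) \<Rightarrow> \<lambda>(v, b). (if u = v then adjacency (tree T h) a b else 0) +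
        (\<Sum>i<t. adjacency (circulant n (k i)) u v * ?E i a b)) y"
      unfolding xy by (subst adjacency_cylindrical_construct_tree[OF _ nbr gr]) (use xy in auto)
  qed simp
  also have "\<dots> = (\<Prod>j<n. charpoly_on ?V (\<lambda>a b. adjacency (tree T h) a b + (\<Sum>i<t. ?\<theta> j i * ?E i a b)))"
    using k by (intro charpoly_on_circulant_sum) auto
  also have "\<dots> = (\<Prod>j<n. F j)"
    unfolding F_def
  proof (intro prod.cong refl charpoly_on_cong)
    fix j a b assume "a \<in> ?V" "b \<in> ?V"
    \<comment> \<open>At most the summand for the leaf \<open>a\<close> survives;
      \<open>t = width T h\<close> ensures that its index is in range.\<close>
    then have "(\<Sum>i<t. ?\<theta> j i * ?E i a b) = (\<Sum>i<t. if i = snd a then leaf_diag h (?\<theta> j) a b else 0)"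
      by (intro sum.cong) (auto simp: leaf_diag_def)
    also have "\<dots> = leaf_diag h (?\<theta> j) a b"
      using \<open>a \<in> ?V\<close> t(1) by (auto simp: leaf_diag_def tree_verts_def)
    finally show "adjacency (tree T h) a b + (\<Sum>i<t. ?\<theta> j i * ?E i a b) =
        adjacency (tree T h) a b + leaf_diag h (?\<theta> j) a b" by simp
  qed simp
  \<comment> \<open>The Fourier index runs from 0 to \<open>n - 1\<close>, the product from 1 to
    \<open>n\<close>; the angles for \<open>j = 0\<close> and \<open>j = n\<close> differ by a
    multiple of \<open>2 pi\<close>.\<close>
  also have "\<dots> = (\<Prod>j=1..n. F j)"
  proof (cases n)
    case (Suc m)
    have "?\<theta> n i = ?\<theta> 0 i" for i
      using Suc cos_int_2pin[of "k i"] by (simp add: mult.assoc)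
    then have "F n = F 0" by (simp add: F_def)
    then show ?thesis
      using Suc by (simp add: prod.atLeast1_atMost_eq prod.lessThan_Suc_shift mult.commute
          del: prod.lessThan_Suc)
  qed simp
  finally show ?thesis by (simp add: F_def)
qed

text \<open>Resultants are rational functions, so the second equality of each part is stated in the
  fraction field via \<open>to_fract\<close>.\<close>

theorem proposition2:
  fixes n t :: nat and k :: "nat \<Rightarrow> int"
  defines "Cs \<equiv> map (\<lambda>i. circulant n (k i)) [0..<t]"
    and "\<theta> \<equiv> \<lambda>(j::nat) (i::nat). 2 * cos (2 * pi * real j * real_of_int (k i) / real n)"
  defines "lab \<equiv> \<lambda>j i. [:- \<theta> j i, 1:]"
  assumes "n \<ge> 3" and "t \<ge> 1"
    and "inj_on k {..<t}"
    and "\<forall>i<t. 1 \<le> k i \<and> real_of_int (k i) \<le> (real n - 1) / 2"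
  shows "(\<forall>h\<ge>1. t = 2 ^ (h + 1) \<longrightarrow>
      graph_charpoly (Cs \<boxtimes> map (tree_cylinder Unrooted h) [0..<t]) =
        (\<Prod>j=1..n. charpoly_on (tree_verts Unrooted h)
           (\<lambda>u v. adjacency (tree Unrooted h) u v + leaf_diag h (\<theta> j) u v)) \<and>
      to_fract (\<Prod>j=1..n. charpoly_on (tree_verts Unrooted h)
           (\<lambda>u v. adjacency (tree Unrooted h) u v + leaf_diag h (\<theta> j) u v)) =
        (\<Prod>j=1..n. resultant_tree Unrooted h (lab j) *
           ((level_resultant Unrooted h (lab j) 0 - 1) / level_resultant Unrooted h (lab j) 0)))
    \<and> (\<forall>h\<ge>1. t = 3 * 2 ^ (h - 1) \<longrightarrow>
      graph_charpoly (Cs \<boxtimes> map (tree_cylinder Rooted h) [0..<t]) =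
        (\<Prod>j=1..n. charpoly_on (tree_verts Rooted h)
           (\<lambda>u v. adjacency (tree Rooted h) u v + leaf_diag h (\<theta> j) u v)) \<and>
      to_fract (\<Prod>j=1..n. charpoly_on (tree_verts Rooted h)
           (\<lambda>u v. adjacency (tree Rooted h) u v + leaf_diag h (\<theta> j) u v)) =
        (\<Prod>j=1..n. resultant_tree Rooted h (lab j)))"
proof -
  have k: "1 \<le> k i \<and> 2 * k i < int n" if "i < t" for i
  proof -
    have "real_of_int (2 * k i) < real_of_int (int n)"
      using assms that by fastforce
    with assms that show ?thesis by (auto simp only: of_int_less_iff)
  qed
  have degree_lab: "degree (lab j i) = 1" for j i
    by (simp add: lab_def)
  \<comment> \<open>Reduces the second equality of both parts to the determinant of the pivot
    matrix.\<close>
  have tree: "to_fract (\<Prod>j=1..n. charpoly_on (tree_verts T h)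
        (\<lambda>u v. adjacency (tree T h) u v + leaf_diag h (\<theta> j) u v)) =
      (\<Prod>j=1..n. det_on (tree_verts T h) (label_diag T h (lab j)))" for T h
    by (simp add: to_fract_hom.hom_prod charpoly_on_tree lab_def)
  show ?thesis
  proof (intro conjI allI impI)
    fix h :: nat assume "t = 2 ^ (h + 1)"
    then have t: "t = width Unrooted h" by simp
    show "graph_charpoly (Cs \<boxtimes> map (tree_cylinder Unrooted h) [0..<t]) =
        (\<Prod>j=1..n. charpoly_on (tree_verts Unrooted h)
           (\<lambda>u v. adjacency (tree Unrooted h) u v + leaf_diag h (\<theta> j) u v))"
      unfolding Cs_def \<theta>_def by (rule graph_charpoly_tree_cylinders[OF t \<open>t \<ge> 1\<close> k])
  next
    fix h :: nat assume "h \<ge> 1" "t = 3 * 2 ^ (h - 1)"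
    \<comment> \<open>\<open>h \<ge> 1\<close> matters: for \<open>h = 0\<close> the width is 1,
      whereas truncated subtraction would give 3.\<close>
    then have t: "t = width Rooted h" by (cases h) auto
    show "graph_charpoly (Cs \<boxtimes> map (tree_cylinder Rooted h) [0..<t]) =
        (\<Prod>j=1..n. charpoly_on (tree_verts Rooted h)
           (\<lambda>u v. adjacency (tree Rooted h) u v + leaf_diag h (\<theta> j) u v))"
      unfolding Cs_def \<theta>_def by (rule graph_charpoly_tree_cylinders[OF t \<open>t \<ge> 1\<close> k])
  qed (simp_all only: tree det_on_label_diag_Rooted det_on_label_diag_Unrooted degree_lab)
qed

end
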